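(* Let $A=\omega_1^*+\omega_1$. There exist linear orders $X$ and $Y$ with $X\not\cong Y$ such that \[ X\cong A\times Y,\qquad X\cong Y\times\omega,\qquad Y\cong A\times X,\qquad Y\cong X\times\omega . \] In particular, there exist two non-isomorphic linear orders each of which is both a left-hand divisor and a right-hand divisor of the other.
   Context: For linear orders $X,Y$, the lexicographical product $X\times Y$ is the set $\{(x,y):x\in X,\ y\in Y\}$ ordered lexicographically (first by $x$, then by $y$); equivalently, it is the order obtained from $X$ by replacing each point of $X$ with a copy of $Y$. For linear orders $X$ and $Y$, $X+Y$ denotes a copy of $X$ followed by a copy of $Y$, and $X^*$ denotes the reverse of $X$. $\omega$ is the order type of the natural numbers and $\omega_1$ is the first uncountable ordinal, so $A=\omega_1^*+\omega_1$ is the reverse of $\omega_1$ followed by $\omega_1$. An order $Z$ is a left-hand divisor of $W$ if $W\cong Z\times B$ for some order $B$, and a right-hand divisor of $W$ if $W\cong B\times Z$ for some order $B$. *)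

theory Defs
  imports Main
begin

text \<open>Linear orders are represented as reflexive order relations (type 'a rel),
  in the sense of Order_Relation: Linear_order r; the carrier is Field r.\<close>

definition order_iso :: "'a rel \<Rightarrow> 'b rel \<Rightarrow> bool" where
  "order_iso r s \<longleftrightarrow> (\<exists>f. bij_betw f (Field r) (Field s) \<and>
     (\<forall>a\<in>Field r. \<forall>b\<in>Field r. (a, b) \<in> r \<longleftrightarrow> (f a, f b) \<in> s))"

definition lexi_prod :: "'a rel \<Rightarrow> 'b rel \<Rightarrow> ('a \<times> 'b) rel" where
  "lexi_prod r s = {((x, y), (x', y')).
     x \<in> Field r \<and> x' \<in> Field r \<and> y \<in> Field s \<and> y' \<in> Field s \<and>
     (((x, x') \<in> r \<and> x \<noteq> x') \<or> (x = x' \<and> (y, y') \<in> s))}"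

definition ord_sum :: "'a rel \<Rightarrow> 'b rel \<Rightarrow> ('a + 'b) rel" where
  "ord_sum r s = map_prod Inl Inl ` r \<union> map_prod Inr Inr ` s \<union>
     (Inl ` Field r) \<times> (Inr ` Field s)"

definition omega_ord :: "nat rel" where
  "omega_ord = {(m, n). m \<le> n}"

text \<open>omega_1: the first uncountable ordinal, realised as the successor cardinal
  of natLeq (a cardinal order, i.e. an initial ordinal, of cardinality aleph_1).\<close>
definition omega1_ord :: "nat set rel" where
  "omega1_ord = cardSuc natLeq"

definition A_ord :: "(nat set + nat set) rel" where
  "A_ord = ord_sum (converse omega1_ord) omega1_ord"

end

theory Submission
  imports Defs "HOL-Library.Nat_Bijection"
begin

text \<open>
  Let \<open>A\<^sup>\<omega>\<close> be ordered lexicographically, and replace each \<open>u \<in> A\<^sup>\<omega>\<close> by a block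
  \<open>L(b)\<close>: the sequences of natural numbers that eventually agree with a sequence \<open>b = b(p, u)\<close>,
  compared at the greatest position where they differ. Splitting off the first entry of \<open>u\<close>
  divides by \<open>A\<close> on the left; splitting off the digit at position 0 of the block divides by
  \<open>\<omega>\<close> on the right, because \<open>L(b)\<close> is \<open>L(b \<circ> Suc) \<times> \<omega>\<close>. If \<open>b\<close> is chosen with
  \<open>b(p, u) \<circ> Suc = b(p + 1, u)\<close> and \<open>b(p, u) = b(p + 1, u \<circ> Suc)\<close>, both operations replace
  \<open>p\<close> by \<open>p + 1\<close>. Take \<open>b(p, u)\<close> to be the indicator of the \<open>n\<close> with \<open>n + p\<close> even (odd) when
  the signs of \<open>u\<close> eventually alternate with the positive ones at even (odd) places, and 0 otherwise.
  It depends on \<open>p\<close> only modulo 2, so \<open>p = 0\<close> and \<open>p = 1\<close> give \<open>X\<close> and \<open>Y\<close>.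

  Suppose \<open>f\<close> is an isomorphism from \<open>X\<close> to \<open>Y\<close>. Two continuous cofinal \<open>\<omega>\<^sub>1\<close>-sequences of cuts
  agree on a club, so some cut just below the cone of sequences starting with a limit
  \<open>\<alpha> \<in> \<omega>\<^sub>1\<close> is fixed by \<open>f\<close>; approaching that cut from above inside the cone, some cut just above
  the cone of a sequence \<open>\<alpha>, \<gamma>\<close> with \<open>\<gamma> \<in> \<omega>\<^sub>1\<^sup>*\<close> is fixed, and so on. The resulting \<open>u\<close> has
  alternating signs and its block in \<open>X\<close> is mapped onto its block in \<open>Y\<close>. This is impossible: the
  vanishing of a given digit is definable from the order of a block, and the two defining sequences
  are the indicators of the even and of the odd numbers.
\<close>

section \<open>Order isomorphisms\<close>

lemma order_iso_sym: "order_iso r s \<Longrightarrow> order_iso s r"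
proof -
  assume "order_iso r s"
  then obtain f where f: "bij_betw f (Field r) (Field s)"
    "\<forall>a\<in>Field r. \<forall>b\<in>Field r. (a, b) \<in> r \<longleftrightarrow> (f a, f b) \<in> s"
    unfolding order_iso_def by blast
  define g where "g = inv_into (Field r) f"
  have g: "bij_betw g (Field s) (Field r)"
    unfolding g_def by (rule bij_betw_inv_into[OF f(1)])
  have "f (g a) = a" if "a \<in> Field s" for a
    unfolding g_def using bij_betw_inv_into_right[OF f(1) that] .
  moreover have "g a \<in> Field r" if "a \<in> Field s" for a
    using bij_betw_apply[OF g that] .
  ultimately have "\<forall>a\<in>Field s. \<forall>b\<in>Field s. (a, b) \<in> s \<longleftrightarrow> (g a, g b) \<in> r"
    using f(2) by simp
  with g show ?thesis unfolding order_iso_def by blast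
qed

lemma order_iso_trans [trans]: "order_iso r s \<Longrightarrow> order_iso s t \<Longrightarrow> order_iso r t"
proof -
  assume "order_iso r s" "order_iso s t"
  then obtain f g where f: "bij_betw f (Field r) (Field s)"
    "\<forall>a\<in>Field r. \<forall>b\<in>Field r. (a, b) \<in> r \<longleftrightarrow> (f a, f b) \<in> s"
    and g: "bij_betw g (Field s) (Field t)"
    "\<forall>a\<in>Field s. \<forall>b\<in>Field s. (a, b) \<in> s \<longleftrightarrow> (g a, g b) \<in> t"
    unfolding order_iso_def by blast
  have "bij_betw (g \<circ> f) (Field r) (Field t)"
    using f(1) g(1) by (rule bij_betw_trans)
  moreover have "\<forall>a\<in>Field r. \<forall>b\<in>Field r. (a, b) \<in> r \<longleftrightarrow> ((g \<circ> f) a, (g \<circ> f) b) \<in> t"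
    using f g(2) bij_betw_apply[OF f(1)] by simp
  ultimately show ?thesis unfolding order_iso_def by blast
qed

lemma order_iso_refl: "order_iso r r"
  unfolding order_iso_def by (rule exI[of _ id]) simp

lemma Field_map_prod_image: "Field (map_prod c c ` r) = c ` Field r"
proof -
  have "Domain (map_prod c c ` r) = c ` Domain r" "Range (map_prod c c ` r) = c ` Range r"
    by (auto simp: Domain_fst Range_snd image_image)
  then show ?thesis by (simp add: Field_def image_Un)
qed

lemma map_prod_image_iff:
  assumes "inj c"
  shows "(c a, c b) \<in> map_prod c c ` r \<longleftrightarrow> (a, b) \<in> r"
  using inj_image_mem_iff[OF prod.inj_map[OF assms assms], of "(a, b)" r] by simp

lemma order_iso_image:
  assumes "inj c"
  shows "order_iso r (map_prod c c ` r)"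
proof -
  have "bij_betw c (Field r) (Field (map_prod c c ` r))"
    unfolding Field_map_prod_image by (rule inj_on_imp_bij_betw[OF inj_on_subset[OF assms subset_UNIV]])
  then show ?thesis
    unfolding order_iso_def by (intro exI[of _ c]) (simp add: map_prod_image_iff[OF assms])
qed

lemma Linear_order_image:
  assumes "inj c" "Linear_order r"
  shows "Linear_order (map_prod c c ` r)"
proof -
  note F = Field_map_prod_image[of c r] and m = map_prod_image_iff[OF assms(1)]
  have e: "\<exists>a b. x = c a \<and> y = c b \<and> (a, b) \<in> r" if "(x, y) \<in> map_prod c c ` r" for x y
    using that by auto
  have refl: "refl_on (Field r) r" and tr: "trans r" and an: "antisym r" and tot: "total_on (Field r) r"
    using assms(2) unfolding order_on_defs by auto
  have "refl_on (c ` Field r) (map_prod c c ` r)"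
    using refl by (auto simp: refl_on_def m)
  moreover have "trans (map_prod c c ` r)"
  proof (rule transI)
    fix x y z assume "(x, y) \<in> map_prod c c ` r" "(y, z) \<in> map_prod c c ` r"
    then obtain a b b' d where "x = c a" "y = c b" "y = c b'" "z = c d" "(a, b) \<in> r" "(b', d) \<in> r"
      using e by metis
    then show "(x, z) \<in> map_prod c c ` r"
      using assms(1) tr by (metis injD m transD)
  qed
  moreover have "antisym (map_prod c c ` r)"
  proof (rule antisymI)
    fix x y assume "(x, y) \<in> map_prod c c ` r" "(y, x) \<in> map_prod c c ` r"
    then obtain a b where "x = c a" "y = c b" "(a, b) \<in> r" "(b, a) \<in> r"
      using e m by metis
    then show "x = y" using an by (metis antisymD)
  qed
  moreover have "total_on (c ` Field r) (map_prod c c ` r)"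
    using tot by (auto simp: total_on_def m)
  moreover have "map_prod c c ` r \<subseteq> (c ` Field r) \<times> (c ` Field r)"
    by (auto simp: Field_def)
  ultimately show ?thesis unfolding order_on_defs F by simp
qed

lemma lexi_prod_iff:
  "((x, y), (x', y')) \<in> lexi_prod r s \<longleftrightarrow> x \<in> Field r \<and> x' \<in> Field r \<and> y \<in> Field s \<and> y' \<in> Field s \<and>
    ((x, x') \<in> r \<and> x \<noteq> x' \<or> x = x' \<and> (y, y') \<in> s)"
  by (simp add: lexi_prod_def)

lemma Field_lexi_prod:
  assumes "Refl r" "Refl s"
  shows "Field (lexi_prod r s) = Field r \<times> Field s"
proof
  show "Field (lexi_prod r s) \<subseteq> Field r \<times> Field s"
    unfolding Field_def[of "lexi_prod r s"] by (auto simp: lexi_prod_def)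
  show "Field r \<times> Field s \<subseteq> Field (lexi_prod r s)"
    unfolding Field_def[of "lexi_prod r s"] using assms(2)
    by (auto simp: lexi_prod_def refl_on_def)
qed

lemma order_iso_lexi_prod:
  assumes "order_iso r r'" "order_iso s s'" "Refl r" "Refl s" "Refl r'" "Refl s'"
  shows "order_iso (lexi_prod r s) (lexi_prod r' s')"
proof -
  from assms obtain f g where f: "bij_betw f (Field r) (Field r')"
    "\<forall>a\<in>Field r. \<forall>b\<in>Field r. (a, b) \<in> r \<longleftrightarrow> (f a, f b) \<in> r'"
    and g: "bij_betw g (Field s) (Field s')"
    "\<forall>a\<in>Field s. \<forall>b\<in>Field s. (a, b) \<in> s \<longleftrightarrow> (g a, g b) \<in> s'"
    unfolding order_iso_def by blast
  have "bij_betw (map_prod f g) (Field r \<times> Field s) (Field r' \<times> Field s')"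
    using f(1) g(1) by (rule bij_betw_map_prod)
  moreover have "\<forall>x\<in>Field r \<times> Field s. \<forall>y\<in>Field r \<times> Field s.
      (x, y) \<in> lexi_prod r s \<longleftrightarrow> (map_prod f g x, map_prod f g y) \<in> lexi_prod r' s'"
    using f g(2) bij_betw_apply[OF f(1)] bij_betw_apply[OF g(1)]
      bij_betw_imp_inj_on[OF f(1)]
    by (auto simp: lexi_prod_def inj_on_eq_iff)
  ultimately show ?thesis
    unfolding order_iso_def Field_lexi_prod[OF assms(3,4)] Field_lexi_prod[OF assms(5,6)] by blast
qed

section \<open>The orders \<open>\<omega>\<^sub>1\<close> and \<open>A\<close>\<close>

definition w1 :: "nat set set" where
  "w1 = Field omega1_ord"

definition w1_less :: "nat set \<Rightarrow> nat set \<Rightarrow> bool" where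
  "w1_less i j \<longleftrightarrow> (i, j) \<in> omega1_ord \<and> i \<noteq> j"

lemma Card_order_omega1: "Card_order omega1_ord"
  unfolding omega1_ord_def by (rule cardSuc_Card_order[OF natLeq_Card_order])

lemma Well_order_omega1: "Well_order omega1_ord"
  using Card_order_omega1 unfolding card_order_on_def by simp

lemma infinite_w1: "infinite w1"
  unfolding w1_def omega1_ord_def
  using cardSuc_finite[OF natLeq_Card_order] by (simp add: Field_natLeq)

lemma w1_props: "refl_on w1 omega1_ord" "trans omega1_ord" "antisym omega1_ord" "total_on w1 omega1_ord"
  "wf (omega1_ord - Id)"
  using Well_order_omega1 unfolding w1_def well_order_on_def order_on_defs by auto

lemma w1_less_trans: "w1_less i j \<Longrightarrow> w1_less j k \<Longrightarrow> w1_less i k"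
  using w1_props(2,3) unfolding w1_less_def by (metis antisymD transD)

lemma w1_less_total: "i \<in> w1 \<Longrightarrow> j \<in> w1 \<Longrightarrow> i \<noteq> j \<Longrightarrow> w1_less i j \<or> w1_less j i"
  using w1_props(4) unfolding w1_less_def total_on_def by metis

lemma w1_less_in: "w1_less i j \<Longrightarrow> i \<in> w1 \<and> j \<in> w1"
  unfolding w1_less_def w1_def by (auto simp: Field_def)

lemma w1_unbounded: "i \<in> w1 \<Longrightarrow> \<exists>j\<in>w1. w1_less i j"
  using infinite_Card_order_limit[OF Card_order_omega1] infinite_w1
  unfolding w1_less_def w1_def by blast

text \<open>Regularity of \<open>\<omega>\<^sub>1\<close>: the initial segments
  \<open>underS omega1_ord i\<close> form a chain that covers \<open>w1\<close>, and a countable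
  subset of the union of such a chain already lies in one member.\<close>

lemma w1_countable_bound:
  assumes "\<And>n::nat. a n \<in> w1"
  shows "\<exists>b\<in>w1. \<forall>n. w1_less (a n) b"
proof -
  have "\<exists>i\<in>Field (cardSuc natLeq). range a \<subseteq> underS omega1_ord i"
  proof (rule cardSuc_UNION[OF natLeq_Card_order])
    show "infinite (Field natLeq)" by (simp add: Field_natLeq)
    show "relChain (cardSuc natLeq) (underS omega1_ord)"
      unfolding relChain_def underS_def omega1_ord_def[symmetric]
      using w1_props(2,3) by (auto dest: transD antisymD)
    show "range a \<subseteq> (\<Union>i\<in>Field (cardSuc natLeq). underS omega1_ord i)"
      unfolding omega1_ord_def[symmetric] w1_def[symmetric] underS_def
      using w1_unbounded assms unfolding w1_less_def by fast
    show "(card_of (range a), natLeq) \<in> ordLeq"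
      using card_of_image[of a UNIV] card_of_nat ordLeq_ordIso_trans by blast
  qed
  then show ?thesis
    unfolding omega1_ord_def[symmetric] w1_def[symmetric] underS_def w1_less_def by blast
qed

text \<open>Well-foundedness provides a least strict upper bound \<open>i\<close>; a smaller
  \<open>k\<close> fails to bound the sequence, and totality places it at or below some
  \<open>a n\<close>.\<close>

lemma w1_sup:
  assumes "\<And>n::nat. a n \<in> w1"
  shows "\<exists>i\<in>w1. (\<forall>n. w1_less (a n) i) \<and> (\<forall>k. w1_less k i \<longrightarrow> (\<exists>n. k = a n \<or> w1_less k (a n)))"
proof -
  define B where "B = {b \<in> w1. \<forall>n. w1_less (a n) b}"
  have B: "k \<in> B \<longleftrightarrow> k \<in> w1 \<and> (\<forall>n. w1_less (a n) k)" for k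
    by (simp add: B_def)
  have "\<exists>b. b \<in> B"
    using w1_countable_bound[of a] assms unfolding B by auto
  then have "\<exists>i\<in>B. \<forall>k. (k, i) \<in> omega1_ord - Id \<longrightarrow> k \<notin> B"
    using w1_props(5) unfolding wf_eq_minimal by simp
  then obtain i where i: "i \<in> B" and min: "\<And>k. w1_less k i \<Longrightarrow> k \<notin> B"
    unfolding w1_less_def by auto
  have "\<exists>n. k = a n \<or> w1_less k (a n)" if k: "w1_less k i" for k
  proof -
    have "k \<in> w1" using w1_less_in[OF k] by simp
    moreover from this obtain n where "\<not> w1_less (a n) k" using min[OF k] unfolding B by auto
    ultimately show ?thesis using w1_less_total[OF assms[of n]] by blast
  qed
  with i show ?thesis unfolding B by auto
qed

definition A_less :: "nat set + nat set \<Rightarrow> nat set + nat set \<Rightarrow> bool" where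
  "A_less a b \<longleftrightarrow> (a, b) \<in> A_ord \<and> a \<noteq> b"

lemma A_ord_iff:
  "(Inl x, Inl y) \<in> A_ord \<longleftrightarrow> (y, x) \<in> omega1_ord"
  "(Inr x, Inr y) \<in> A_ord \<longleftrightarrow> (x, y) \<in> omega1_ord"
  "(Inl x, Inr y) \<in> A_ord \<longleftrightarrow> x \<in> w1 \<and> y \<in> w1"
  "(Inr x, Inl y) \<notin> A_ord"
  by (auto simp: A_ord_def ord_sum_def w1_def image_iff Bex_def)

lemma Field_A: "Field A_ord = Inl ` w1 \<union> Inr ` w1"
proof -
  have "a \<in> Field A_ord \<longleftrightarrow> a \<in> Inl ` w1 \<union> Inr ` w1" for a
  proof (cases a)
    case (Inl x)
    have "(x, x) \<in> omega1_ord" if "x \<in> w1" using w1_props(1) that by (auto simp: refl_on_def)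
    moreover have "x \<in> w1" if "Inl x \<in> Field A_ord"
      using that unfolding Field_def A_ord_def ord_sum_def w1_def by auto
    moreover have "Inl x \<in> Field A_ord" if "(x, x) \<in> omega1_ord"
      using that A_ord_iff(1)[of x x] by (meson FieldI1)
    ultimately show ?thesis using Inl by auto
  next
    case (Inr x)
    have "(x, x) \<in> omega1_ord" if "x \<in> w1" using w1_props(1) that by (auto simp: refl_on_def)
    moreover have "x \<in> w1" if "Inr x \<in> Field A_ord"
      using that unfolding Field_def A_ord_def ord_sum_def w1_def by auto
    moreover have "Inr x \<in> Field A_ord" if "(x, x) \<in> omega1_ord"
      using that A_ord_iff(2)[of x x] by (meson FieldI1)
    ultimately show ?thesis using Inr by auto
  qed
  then show ?thesis by blast
qed

lemma A_less_simps [simp]: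
  "A_less (Inl x) (Inl y) \<longleftrightarrow> w1_less y x"
  "A_less (Inr x) (Inr y) \<longleftrightarrow> w1_less x y"
  "A_less (Inl x) (Inr y) \<longleftrightarrow> x \<in> w1 \<and> y \<in> w1"
  "\<not> A_less (Inr x) (Inl y)"
  by (auto simp: A_less_def A_ord_iff w1_less_def)

lemma A_ord_less: "(a, b) \<in> A_ord \<longleftrightarrow> a \<in> Field A_ord \<and> b \<in> Field A_ord \<and> (a = b \<or> A_less a b)"
proof -
  have "(a, a) \<in> A_ord" if "a \<in> Field A_ord"
    using that w1_props(1) unfolding Field_A by (auto simp: A_ord_iff refl_on_def)
  then show ?thesis
    unfolding A_less_def by (auto intro: FieldI1 FieldI2)
qed

section \<open>Lexicographic orders on sequences\<close>

text \<open>Kept abstract so that the same facts serve \<open>A_less\<close> and its converse.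
  Totality is confined to the carrier, so that only comparisons of arbitrary sequences need
  membership hypotheses.\<close>

locale strict_linear =
  fixes A :: "'a set" and lt :: "'a \<Rightarrow> 'a \<Rightarrow> bool"
  assumes irrefl: "\<not> lt a a"
    and trans: "lt a b \<Longrightarrow> lt b c \<Longrightarrow> lt a c"
    and total: "a \<in> A \<Longrightarrow> b \<in> A \<Longrightarrow> a \<noteq> b \<Longrightarrow> lt a b \<or> lt b a"

text \<open>The index \<open>n\<close> refers to a cone: \<open>v\<close> lies beyond every sequence
  that shares the first \<open>n\<close> entries of \<open>u\<close>. Exchanging the arguments gives
  the cut at the other end of the cone.\<close>

definition lex_upto :: "('a \<Rightarrow> 'a \<Rightarrow> bool) \<Rightarrow> nat \<Rightarrow> (nat \<Rightarrow> 'a) \<Rightarrow> (nat \<Rightarrow> 'a) \<Rightarrow> bool" where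
  "lex_upto lt n u v \<longleftrightarrow> (\<exists>k<n. (\<forall>i<k. u i = v i) \<and> lt (u k) (v k))"

definition lex_less :: "('a \<Rightarrow> 'a \<Rightarrow> bool) \<Rightarrow> (nat \<Rightarrow> 'a) \<Rightarrow> (nat \<Rightarrow> 'a) \<Rightarrow> bool" where
  "lex_less lt u v \<longleftrightarrow> (\<exists>n. lex_upto lt n u v)"

lemma lex_less_alt: "lex_less lt u v \<longleftrightarrow> (\<exists>k. (\<forall>i<k. u i = v i) \<and> lt (u k) (v k))"
  unfolding lex_less_def lex_upto_def by blast

lemma lex_upto_converse: "lex_upto lt\<inverse>\<inverse> n u v \<longleftrightarrow> lex_upto lt n v u"
  unfolding lex_upto_def by (auto simp: eq_commute)

lemma lex_less_converse: "lex_less lt\<inverse>\<inverse> u v \<longleftrightarrow> lex_less lt v u"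
  unfolding lex_less_def lex_upto_converse ..

context strict_linear
begin

lemma lex_upto_irrefl: "\<forall>i<n. u i = v i \<Longrightarrow> \<not> lex_upto lt n u v"
  using irrefl unfolding lex_upto_def by auto

lemma lex_upto_trans: "lex_upto lt n u v \<Longrightarrow> lex_upto lt n v w \<Longrightarrow> lex_upto lt n u w"
proof -
  assume "lex_upto lt n u v" "lex_upto lt n v w"
  then obtain k l where k: "k < n" "\<forall>i<k. u i = v i" "lt (u k) (v k)"
    and l: "l < n" "\<forall>i<l. v i = w i" "lt (v l) (w l)"
    unfolding lex_upto_def by blast
  have "lt (u (min k l)) (w (min k l))"
    using k l trans by (cases k l rule: linorder_cases) auto
  then show ?thesis unfolding lex_upto_def
    using k l by (intro exI[of _ "min k l"]) auto
qed

lemma lex_upto_agree: "lex_upto lt n u v \<Longrightarrow> \<forall>i<n. v i = w i \<Longrightarrow> lex_upto lt n u w"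
  "\<forall>i<n. u i = v i \<Longrightarrow> lex_upto lt n v w \<Longrightarrow> lex_upto lt n u w"
  unfolding lex_upto_def by fastforce+

lemma lex_upto_total:
  assumes "\<And>i. u i \<in> A" "\<And>i. v i \<in> A"
  shows "(\<forall>i<n. u i = v i) \<or> lex_upto lt n u v \<or> lex_upto lt n v u"
proof (cases "\<forall>i<n. u i = v i")
  case False
  then obtain i where i: "i < n" "u i \<noteq> v i" by blast
  define k where "k = (LEAST i. u i \<noteq> v i)"
  have "u k \<noteq> v k" unfolding k_def by (rule LeastI[of "\<lambda>i. u i \<noteq> v i", OF i(2)])
  moreover have "\<forall>i<k. u i = v i" using not_less_Least unfolding k_def by blast
  moreover have "k < n" using Least_le[of "\<lambda>i. u i \<noteq> v i", OF i(2)] i(1) unfolding k_def by simp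
  ultimately
  show ?thesis
    using total[OF assms(1)[of k] assms(2)[of k]] unfolding lex_upto_def by (auto intro!: exI[of _ k])
qed simp

lemma lex_upto_mono: "lex_upto lt n u v \<Longrightarrow> n \<le> m \<Longrightarrow> lex_upto lt m u v"
  unfolding lex_upto_def by (meson less_le_trans)

lemma lex_less_trans: "lex_less lt u v \<Longrightarrow> lex_less lt v w \<Longrightarrow> lex_less lt u w"
  unfolding lex_less_def by (meson lex_upto_mono lex_upto_trans max.cobounded1 max.cobounded2)

lemma lex_less_irrefl: "\<not> lex_less lt u u"
  unfolding lex_less_def using lex_upto_irrefl by blast

lemma lex_less_total:
  assumes "\<And>i. u i \<in> A" "\<And>i. v i \<in> A" "u \<noteq> v"
  shows "lex_less lt u v \<or> lex_less lt v u"
proof -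
  obtain k where "u k \<noteq> v k" using assms(3) by blast
  then show ?thesis using lex_upto_total[of u v "Suc k"] assms(1,2) unfolding lex_less_def by blast
qed

end

interpretation A: strict_linear "Field A_ord" A_less
proof
  show "\<not> A_less a a" for a by (simp add: A_less_def)
  show "A_less a c" if "A_less a b" "A_less b c" for a b c
    using that by (cases a; cases b; cases c) (auto dest: w1_less_trans w1_less_in)
  show "A_less a b \<or> A_less b a" if "a \<in> Field A_ord" "b \<in> Field A_ord" "a \<noteq> b" for a b
    using that w1_less_total unfolding Field_A by (elim UnE imageE) simp_all
qed

section \<open>Digit sequences compared at the greatest difference\<close>

definition dig_less :: "(nat \<Rightarrow> nat) \<Rightarrow> (nat \<Rightarrow> nat) \<Rightarrow> bool" where
  "dig_less s t \<longleftrightarrow> (\<exists>n. s n < t n \<and> (\<forall>m>n. s m = t m))"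

lemma dig_less_irrefl: "\<not> dig_less s s"
  by (simp add: dig_less_def)

lemma dig_less_trans: "dig_less s t \<Longrightarrow> dig_less t r \<Longrightarrow> dig_less s r"
proof -
  assume "dig_less s t" "dig_less t r"
  then obtain k l where k: "s k < t k" "\<forall>m>k. s m = t m" and l: "t l < r l" "\<forall>m>l. t m = r m"
    unfolding dig_less_def by blast
  have "s (max k l) < r (max k l)"
    using k l by (cases k l rule: linorder_cases) (auto simp: max_def)
  then show ?thesis unfolding dig_less_def
    using k l by (intro exI[of _ "max k l"]) auto
qed

definition tail_class :: "(nat \<Rightarrow> nat) \<Rightarrow> (nat \<Rightarrow> nat) set" where
  "tail_class c = {s. \<forall>\<^sub>F n in sequentially. s n = c n}"

text \<open>Members of one tail class differ at finitely many places only, so there is a greatest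
  place at which to compare them.\<close>

lemma dig_less_total:
  assumes "s \<in> tail_class c" "t \<in> tail_class c" "s \<noteq> t"
  shows "dig_less s t \<or> dig_less t s"
proof -
  have "\<forall>\<^sub>F n in sequentially. s n = t n"
    using assms(1,2) unfolding tail_class_def mem_Collect_eq by eventually_elim simp
  then obtain N where N: "\<forall>n\<ge>N. s n = t n" unfolding eventually_sequentially by blast
  let ?D = "{n. s n \<noteq> t n}"
  have fin: "finite ?D"
    by (rule finite_subset[of _ "{..N}"]) (use N nat_le_linear in auto)
  have ne: "?D \<noteq> {}" using assms(3) by auto
  obtain k where k: "k = Max ?D" by simp
  have "s k \<noteq> t k" using Max_in[OF fin ne] unfolding k by blast
  moreover have above: "\<forall>m>k. s m = t m"
    using Max_ge[OF fin] unfolding k by (metis (mono_tags, lifting) mem_Collect_eq not_less)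
  ultimately have "s k < t k \<or> t k < s k" by (simp add: nat_neq_iff)
  with above show ?thesis unfolding dig_less_def by (auto simp: eq_commute)
qed

section \<open>The orders \<open>X\<close> and \<open>Y\<close>\<close>

definition alternating :: "(nat \<Rightarrow> 'a + 'b) \<Rightarrow> nat \<Rightarrow> bool" where
  "alternating u m \<longleftrightarrow> (\<forall>\<^sub>F k in sequentially. \<not> isl (u k) \<longleftrightarrow> even (k + m))"

text \<open>Being an eventual property, alternation survives the loss of one entry; the remaining
  entries move by one place, which the offset compensates.\<close>

lemma alternating_Suc: "alternating (u \<circ> Suc) m \<longleftrightarrow> alternating u (Suc m)"
proof -
  have "alternating u (Suc m) \<longleftrightarrow> (\<forall>\<^sub>F k in sequentially. \<not> isl (u (Suc k)) \<longleftrightarrow> even (Suc k + Suc m))"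
    unfolding alternating_def
    by (rule eventually_sequentially_Suc[symmetric, of "\<lambda>k. \<not> isl (u k) \<longleftrightarrow> even (k + Suc m)"])
  then show ?thesis unfolding alternating_def by simp
qed

lemma alternating_add2: "alternating u (Suc (Suc m)) \<longleftrightarrow> alternating u m"
  unfolding alternating_def by simp

text \<open>Shifting \<open>u\<close> and shifting \<open>n\<close> both amount to shifting \<open>p\<close>; see \<open>base_shift\<close>.\<close>

definition base :: "nat \<Rightarrow> (nat \<Rightarrow> 'a + 'b) \<Rightarrow> nat \<Rightarrow> nat" where
  "base p u n = of_bool (alternating u (n + p))"

definition points :: "nat \<Rightarrow> ((nat \<Rightarrow> nat set + nat set) \<times> (nat \<Rightarrow> nat)) set" where
  "points p = {(u, s). (\<forall>n. u n \<in> Field A_ord) \<and> s \<in> tail_class (base p u)}"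

definition point_less ::
  "(nat \<Rightarrow> nat set + nat set) \<times> (nat \<Rightarrow> nat) \<Rightarrow> (nat \<Rightarrow> nat set + nat set) \<times> (nat \<Rightarrow> nat) \<Rightarrow> bool" where
  "point_less x y \<longleftrightarrow> lex_less A_less (fst x) (fst y) \<or> fst x = fst y \<and> dig_less (snd x) (snd y)"

definition block_order :: "nat \<Rightarrow> ((nat \<Rightarrow> nat set + nat set) \<times> (nat \<Rightarrow> nat)) rel" where
  "block_order p = {(x, y). x \<in> points p \<and> y \<in> points p \<and> (x = y \<or> point_less x y)}"

lemma block_order_iff: "(x, y) \<in> block_order p \<longleftrightarrow> x \<in> points p \<and> y \<in> points p \<and> (x = y \<or> point_less x y)"
  by (simp add: block_order_def)

lemma Field_block_order: "Field (block_order p) = points p"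
  unfolding Field_def block_order_def by auto

lemma point_less_irrefl: "\<not> point_less x x"
  unfolding point_less_def using A.lex_less_irrefl dig_less_irrefl by blast

lemma point_less_trans: "point_less x y \<Longrightarrow> point_less y z \<Longrightarrow> point_less x z"
  unfolding point_less_def by (auto intro: A.lex_less_trans dig_less_trans)

lemma point_less_total:
  assumes "x \<in> points p" "y \<in> points p" "x \<noteq> y"
  shows "point_less x y \<or> point_less y x"
proof (cases "fst x = fst y")
  case True
  then have "snd x \<noteq> snd y" using assms(3) by (simp add: prod_eq_iff)
  then show ?thesis
    using dig_less_total[of "snd x" "base p (fst x)" "snd y"] True assms(1,2)
    unfolding points_def point_less_def by auto
next
  case False
  then show ?thesis
    using A.lex_less_total[of "fst x" "fst y"] assms(1,2)
    unfolding points_def point_less_def by auto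
qed

lemma Linear_order_block_order: "Linear_order (block_order p)"
  unfolding order_on_defs Field_block_order
proof (intro conjI)
  show "refl_on (points p) (block_order p)" by (auto simp: block_order_def refl_on_def)
  show "trans (block_order p)"
    by (rule transI) (auto simp: block_order_def dest: point_less_trans)
  show "antisym (block_order p)"
    by (rule antisymI) (auto simp: block_order_def dest: point_less_trans simp: point_less_irrefl)
  show "total_on (points p) (block_order p)"
    using point_less_total by (auto simp: block_order_def total_on_def)
  show "block_order p \<subseteq> points p \<times> points p" by (auto simp: block_order_def)
qed

lemma Refl_block_order: "Refl (block_order p)"
  using Linear_order_block_order unfolding order_on_defs by blast

lemma Refl_A: "Refl A_ord"
  by (auto simp: refl_on_def A_ord_less)

lemma omega: "Field omega_ord = UNIV" "Refl omega_ord"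
proof -
  show "Field omega_ord = UNIV" by (force simp: Field_def omega_ord_def)
  then show "Refl omega_ord" by (auto simp: refl_on_def omega_ord_def)
qed

text \<open>In the first equation the shift of \<open>u\<close> and the shift of \<open>p\<close>
  together raise the offset by 2, which parity does not see. The second only moves a successor from
  \<open>n\<close> to \<open>p\<close>.\<close>

lemma base_shift: "base (Suc p) (u \<circ> Suc) = base p u" "base p u \<circ> Suc = base (Suc p) u"
  by (auto simp: base_def alternating_Suc alternating_add2)

lemma tail_class_Suc: "s \<circ> Suc \<in> tail_class (c \<circ> Suc) \<longleftrightarrow> s \<in> tail_class c"
  unfolding tail_class_def
  using eventually_sequentially_Suc[of "\<lambda>n. s n = c n"] by simp

lemma block_order_add2: "block_order (Suc (Suc p)) = block_order p"
proof -
  have "base (Suc (Suc p)) u = base p u" for u :: "nat \<Rightarrow> nat set + nat set"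
    by (simp add: base_def alternating_add2 fun_eq_iff)
  then show ?thesis unfolding block_order_def points_def by simp
qed

section \<open>Splitting off \<open>A\<close> on the left and \<omega> on the right\<close>

lemma lex_less_first:
  "lex_less lt u v \<longleftrightarrow> lt (u 0) (v 0) \<or> u 0 = v 0 \<and> lex_less lt (u \<circ> Suc) (v \<circ> Suc)"
proof
  assume "lex_less lt u v"
  then obtain k where k: "\<forall>i<k. u i = v i" "lt (u k) (v k)" unfolding lex_less_alt by blast
  then show "lt (u 0) (v 0) \<or> u 0 = v 0 \<and> lex_less lt (u \<circ> Suc) (v \<circ> Suc)"
    unfolding lex_less_alt
    by (cases k) (auto intro!: exI[of _ "k - 1"])
next
  assume "lt (u 0) (v 0) \<or> u 0 = v 0 \<and> lex_less lt (u \<circ> Suc) (v \<circ> Suc)"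
  then show "lex_less lt u v"
  proof
    assume "u 0 = v 0 \<and> lex_less lt (u \<circ> Suc) (v \<circ> Suc)"
    then obtain k where "u 0 = v 0" "\<forall>i<k. u (Suc i) = v (Suc i)" "lt (u (Suc k)) (v (Suc k))"
      unfolding lex_less_alt by auto
    then have "\<forall>i<Suc k. u i = v i" by (auto simp: less_Suc_eq_0_disj)
    then show ?thesis using \<open>lt (u (Suc k)) (v (Suc k))\<close> unfolding lex_less_alt by blast
  qed (auto simp: lex_less_alt)
qed

text \<open>Digit 0 is the least significant one: it decides only if all others agree. This is why
  it becomes the right-hand factor.\<close>

lemma dig_less_first:
  "dig_less s t \<longleftrightarrow> dig_less (s \<circ> Suc) (t \<circ> Suc) \<or> s \<circ> Suc = t \<circ> Suc \<and> s 0 < t 0"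
proof
  assume "dig_less s t"
  then obtain k where k: "s k < t k" "\<forall>m>k. s m = t m" unfolding dig_less_def by blast
  then show "dig_less (s \<circ> Suc) (t \<circ> Suc) \<or> s \<circ> Suc = t \<circ> Suc \<and> s 0 < t 0"
    unfolding dig_less_def by (cases k) auto
next
  assume "dig_less (s \<circ> Suc) (t \<circ> Suc) \<or> s \<circ> Suc = t \<circ> Suc \<and> s 0 < t 0"
  then show "dig_less s t"
  proof
    assume "dig_less (s \<circ> Suc) (t \<circ> Suc)"
    then obtain k where "s (Suc k) < t (Suc k)" "\<forall>m>k. s (Suc m) = t (Suc m)"
      unfolding dig_less_def by auto
    then show ?thesis unfolding dig_less_def
      by (intro exI[of _ "Suc k"]) (auto simp: Suc_less_eq2)
  next
    assume a: "s \<circ> Suc = t \<circ> Suc \<and> s 0 < t 0"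
    then have "\<forall>m>0. s m = t m" by (metis comp_apply gr0_conv_Suc)
    with a show ?thesis unfolding dig_less_def by blast
  qed
qed

lemma seq_eq_first: "u = v \<longleftrightarrow> u 0 = v 0 \<and> u \<circ> Suc = v \<circ> Suc"
  by (auto simp: fun_eq_iff) (metis not0_implies_Suc)

lemma case_nat_Suc: "case_nat a u \<circ> Suc = u"
  by auto

lemma case_nat_eta: "case_nat (u 0) (u \<circ> Suc) = u"
  by (auto simp: fun_eq_iff split: nat.split)

text \<open>The entry \<open>u 0\<close> is the most significant coordinate. The digits stay
  unchanged, and by \<open>base_shift\<close> their tail class is also the one attached to
  \<open>u \<circ> Suc\<close> with parameter \<open>Suc p\<close>.\<close>

lemma block_order_iso_A_times: "order_iso (block_order p) (lexi_prod A_ord (block_order (Suc p)))"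
proof -
  define f :: "(nat \<Rightarrow> nat set + nat set) \<times> (nat \<Rightarrow> nat) \<Rightarrow> _"
    where "f = (\<lambda>(u, s). (u 0, (u \<circ> Suc, s)))"
  have F: "Field (lexi_prod A_ord (block_order (Suc p))) = Field A_ord \<times> points (Suc p)"
    unfolding Field_lexi_prod[OF Refl_A Refl_block_order] Field_block_order ..
  have "bij_betw f (points p) (Field A_ord \<times> points (Suc p))"
  proof (rule bij_betw_byWitness[where f' = "\<lambda>(a, (u, s)). (case_nat a u, s)"])
    show "\<forall>x\<in>points p. (\<lambda>(a, (u, s)). (case_nat a u, s)) (f x) = x"
      by (auto simp: f_def case_nat_eta)
    show "\<forall>y\<in>Field A_ord \<times> points (Suc p). f ((\<lambda>(a, (u, s)). (case_nat a u, s)) y) = y"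
      by (auto simp: f_def case_nat_Suc)
    show "f ` points p \<subseteq> Field A_ord \<times> points (Suc p)"
      by (auto simp: f_def points_def base_shift)
    have "base p (case_nat a u) = base (Suc p) u" for a and u :: "nat \<Rightarrow> nat set + nat set"
      using base_shift(1)[of p "case_nat a u"] by (simp add: case_nat_Suc)
    then show "(\<lambda>(a, (u, s)). (case_nat a u, s)) ` (Field A_ord \<times> points (Suc p)) \<subseteq> points p"
      by (auto simp: points_def split: nat.split)
  qed
  moreover have "(x, y) \<in> block_order p \<longleftrightarrow> (f x, f y) \<in> lexi_prod A_ord (block_order (Suc p))"
    if "x \<in> points p" "y \<in> points p" for x y
  proof -
    obtain u s v t where [simp]: "x = (u, s)" "y = (v, t)" by (metis surj_pair)
    have m: "(u \<circ> Suc, s) \<in> points (Suc p)" "(v \<circ> Suc, t) \<in> points (Suc p)"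
      and a: "u 0 \<in> Field A_ord" "v 0 \<in> Field A_ord"
      using that by (auto simp: points_def base_shift)
    have e: "(u = v \<and> s = t \<or> lex_less A_less u v \<or> u = v \<and> dig_less s t) \<longleftrightarrow>
      A_less (u 0) (v 0) \<or> u 0 = v 0 \<and> (u \<circ> Suc = v \<circ> Suc \<and> s = t \<or>
        lex_less A_less (u \<circ> Suc) (v \<circ> Suc) \<or> u \<circ> Suc = v \<circ> Suc \<and> dig_less s t)"
      using lex_less_first[of A_less u v] seq_eq_first[of u v] by blast
    have "(x, y) \<in> block_order p \<longleftrightarrow> u = v \<and> s = t \<or> lex_less A_less u v \<or> u = v \<and> dig_less s t"
      using that by (simp add: block_order_def point_less_def)
    moreover have "(f x, f y) \<in> lexi_prod A_ord (block_order (Suc p)) \<longleftrightarrow>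
      A_less (u 0) (v 0) \<or> u 0 = v 0 \<and> (u \<circ> Suc = v \<circ> Suc \<and> s = t \<or>
        lex_less A_less (u \<circ> Suc) (v \<circ> Suc) \<or> u \<circ> Suc = v \<circ> Suc \<and> dig_less s t)"
      using m a by (simp add: f_def lexi_prod_iff Field_block_order block_order_iff point_less_def A_less_def)
    ultimately show ?thesis using e by simp
  qed
  ultimately show ?thesis unfolding order_iso_def F Field_block_order by blast
qed

text \<open>Here \<open>u\<close> stays unchanged and the digits are shifted;
  \<open>base_shift\<close> shows that the shifted digits belong to the tail class for
  \<open>Suc p\<close>, while digit 0 ranges freely over \<omega>.\<close>

lemma block_order_iso_times_omega: "order_iso (block_order p) (lexi_prod (block_order (Suc p)) omega_ord)"
proof -
  define f :: "(nat \<Rightarrow> nat set + nat set) \<times> (nat \<Rightarrow> nat) \<Rightarrow> _"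
    where "f = (\<lambda>(u, s). ((u, s \<circ> Suc), s 0))"
  have F: "Field (lexi_prod (block_order (Suc p)) omega_ord) = points (Suc p) \<times> UNIV"
    unfolding Field_lexi_prod[OF Refl_block_order omega(2)] Field_block_order omega(1) ..
  have mem: "(u, s \<circ> Suc) \<in> points (Suc p) \<longleftrightarrow> (u, s) \<in> points p" for u s
    using tail_class_Suc[of s "base p u"] by (auto simp: points_def base_shift)
  have "bij_betw f (points p) (points (Suc p) \<times> UNIV)"
  proof (rule bij_betw_byWitness[where f' = "\<lambda>((u, s), a). (u, case_nat a s)"])
    show "\<forall>x\<in>points p. (\<lambda>((u, s), a). (u, case_nat a s)) (f x) = x"
      by (auto simp: f_def case_nat_eta)
    show "\<forall>y\<in>points (Suc p) \<times> UNIV. f ((\<lambda>((u, s), a). (u, case_nat a s)) y) = y"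
      by (auto simp: f_def case_nat_Suc)
    show "f ` points p \<subseteq> points (Suc p) \<times> UNIV"
      by (auto simp: f_def mem)
    show "(\<lambda>((u, s), a). (u, case_nat a s)) ` (points (Suc p) \<times> UNIV) \<subseteq> points p"
      by (auto simp: case_nat_Suc simp flip: mem)
  qed
  moreover have "(x, y) \<in> block_order p \<longleftrightarrow> (f x, f y) \<in> lexi_prod (block_order (Suc p)) omega_ord"
    if "x \<in> points p" "y \<in> points p" for x y
  proof -
    obtain u s v t where [simp]: "x = (u, s)" "y = (v, t)" by (metis surj_pair)
    have m: "(u, s \<circ> Suc) \<in> points (Suc p)" "(v, t \<circ> Suc) \<in> points (Suc p)"
      using that by (auto simp: mem)
    \<comment> \<open>The strict case of \<open>lexi_prod\<close> asks for distinct first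
      components, which irreflexivity provides.\<close>
    have ne: "dig_less (s \<circ> Suc) (t \<circ> Suc) \<Longrightarrow> s \<circ> Suc \<noteq> t \<circ> Suc" "lex_less A_less u v \<Longrightarrow> u \<noteq> v"
      using dig_less_irrefl A.lex_less_irrefl by metis+
    have "(x, y) \<in> block_order p \<longleftrightarrow> u = v \<and> s = t \<or> lex_less A_less u v \<or> u = v \<and> dig_less s t"
      using that by (simp add: block_order_def point_less_def)
    moreover have "(f x, f y) \<in> lexi_prod (block_order (Suc p)) omega_ord \<longleftrightarrow>
      lex_less A_less u v \<or> u = v \<and> dig_less (s \<circ> Suc) (t \<circ> Suc) \<or>
        u = v \<and> s \<circ> Suc = t \<circ> Suc \<and> s 0 \<le> t 0"
      using m ne by (simp add: f_def lexi_prod_iff Field_block_order block_order_iff point_less_def omega(1)) (auto simp: omega_ord_def)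
    ultimately show ?thesis
      using dig_less_first[of s t] seq_eq_first[of s t] by (auto simp: le_less)
  qed
  ultimately show ?thesis unfolding order_iso_def F Field_block_order by blast
qed

section \<open>Isomorphisms between blocks\<close>

lemma dig_less_asym: "dig_less s t \<Longrightarrow> \<not> dig_less t s"
  using dig_less_trans dig_less_irrefl by blast

lemma tail_class_modify:
  assumes "s \<in> tail_class c" "\<And>i. i > k \<Longrightarrow> t i = s i"
  shows "t \<in> tail_class c"
proof -
  have "\<forall>\<^sub>F n in sequentially. n > k" by (rule eventually_gt_at_top)
  with assms(1) show ?thesis
    unfolding tail_class_def mem_Collect_eq by eventually_elim (use assms(2) in simp)
qed

text \<open>Iterated limits from below, expressed by the order alone so that isomorphisms preserve
  them: rank \<open>n + 1\<close> means being approached from below by points of rank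
  \<open>n\<close>. A least point has every rank vacuously.\<close>

primrec limit_rank :: "(nat \<Rightarrow> nat) set \<Rightarrow> nat \<Rightarrow> (nat \<Rightarrow> nat) \<Rightarrow> bool" where
  "limit_rank S 0 s \<longleftrightarrow> True"
| "limit_rank S (Suc n) s \<longleftrightarrow>
     (\<forall>y\<in>S. dig_less y s \<longrightarrow> (\<exists>z\<in>S. limit_rank S n z \<and> dig_less y z \<and> dig_less z s))"

text \<open>If \<open>s\<close> has least nonzero digit \<open>i \<le> n\<close>, nothing between \<open>s(i := s i - 1)\<close> and \<open>s\<close> has rank \<open>n\<close>.\<close>

lemma limit_rank_iff:
  "s \<in> tail_class c \<Longrightarrow> limit_rank (tail_class c) n s \<longleftrightarrow> (\<forall>i<n. s i = 0)"
proof (induction n arbitrary: s)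
  case (Suc n)
  show ?case
  proof
    assume L: "limit_rank (tail_class c) (Suc n) s"
    show "\<forall>i<Suc n. s i = 0"
    proof (rule ccontr)
      assume "\<not> (\<forall>i<Suc n. s i = 0)"
      then have ex: "\<exists>i. i \<le> n \<and> s i \<noteq> 0" by (auto simp: less_Suc_eq_le)
      define i where "i = (LEAST i. i \<le> n \<and> s i \<noteq> 0)"
      have i: "i \<le> n" "s i \<noteq> 0" using LeastI_ex[OF ex] unfolding i_def by auto
      have below: "s j = 0" if "j < i" for j
        using not_less_Least[of j "\<lambda>i. i \<le> n \<and> s i \<noteq> 0"] that i(1) unfolding i_def[symmetric] by auto
      define y where "y = s(i := s i - 1)"
      have "y \<in> tail_class c"
        by (rule tail_class_modify[OF Suc.prems, of i]) (simp add: y_def)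
      moreover have "dig_less y s"
        unfolding dig_less_def by (rule exI[of _ i]) (use i in \<open>simp add: y_def\<close>)
      ultimately obtain z where z: "z \<in> tail_class c" "limit_rank (tail_class c) n z"
        "dig_less y z" "dig_less z s"
        using L by auto
      have z0: "z j = 0" if "j < n" for j using z(2) Suc.IH[OF z(1)] that by simp
      obtain k where k: "y k < z k" "\<forall>m>k. y m = z m" using z(3) unfolding dig_less_def by blast
      obtain l where l: "z l < s l" "\<forall>m>l. z m = s m" using z(4) unfolding dig_less_def by blast
      \<comment> \<open>The point \<open>z\<close> is squeezed between \<open>y\<close> and
        \<open>s\<close>, which agree above \<open>i\<close> and differ by 1 at \<open>i\<close>. So
        its greatest difference from \<open>y\<close> is below \<open>i\<close>, where it would need
        a positive digit, but rank \<open>n\<close> makes that digit 0.\<close>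
      have "l \<le> i"
      proof (rule ccontr)
        assume "\<not> l \<le> i"
        then have "y l = s l" by (simp add: y_def)
        with k l \<open>\<not> l \<le> i\<close> show False
          by (cases k l rule: linorder_cases) (auto simp: y_def)
      qed
      moreover have "\<not> l < i" using l(1) below by auto
      ultimately have "l = i" by simp
      then have "k \<le> i" using k(1) l(2) by (cases "k \<le> i") (auto simp: y_def)
      moreover have "k \<noteq> i" using k(1) l(1) \<open>l = i\<close> by (auto simp: y_def)
      ultimately have "k < i" by simp
      then show False using z0[of k] k(1) i(1) by simp
    qed
  next
    assume s0: "\<forall>i<Suc n. s i = 0"
    have "\<exists>z\<in>tail_class c. limit_rank (tail_class c) n z \<and> dig_less y z \<and> dig_less z s"
      if y: "y \<in> tail_class c" "dig_less y s" for y
    proof -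
      obtain k where k: "y k < s k" "\<forall>m>k. y m = s m" using y(2) unfolding dig_less_def by blast
      have kn: "n < k" using k(1) s0 by (metis not_less_eq not_less_zero)
      \<comment> \<open>Raising digit \<open>n\<close> puts \<open>z\<close> above \<open>y\<close>,
        and clearing the digits below gives it rank \<open>n\<close>. It stays below
        \<open>s\<close>, since \<open>y\<close> is smaller than \<open>s\<close> at the untouched
        place \<open>k > n\<close>.\<close>
      define z where "z i = (if i < n then 0 else if i = n then Suc (y n) else y i)" for i
      have zc: "z \<in> tail_class c"
        by (rule tail_class_modify[OF y(1), of n]) (simp add: z_def)
      have "limit_rank (tail_class c) n z" unfolding Suc.IH[OF zc] by (simp add: z_def)
      moreover have "dig_less y z"
        unfolding dig_less_def by (rule exI[of _ n]) (simp add: z_def)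
      moreover have "dig_less z s"
        unfolding dig_less_def by (rule exI[of _ k]) (use k kn in \<open>simp add: z_def\<close>)
      ultimately show ?thesis using zc by blast
    qed
    then show "limit_rank (tail_class c) (Suc n) s" by simp
  qed
qed simp

text \<open>Order-theoretically: the largest point of rank \<open>n\<close> below \<open>s\<close>, which is \<open>s\<close> with the digits
  below \<open>n\<close> erased, has rank \<open>n + 1\<close>.\<close>

definition zero_digit :: "(nat \<Rightarrow> nat) set \<Rightarrow> nat \<Rightarrow> (nat \<Rightarrow> nat) \<Rightarrow> bool" where
  "zero_digit S n s \<longleftrightarrow> (\<exists>z\<in>S. limit_rank S (Suc n) z \<and> (z = s \<or> dig_less z s) \<and>
     (\<forall>w\<in>S. limit_rank S n w \<and> (w = s \<or> dig_less w s) \<longrightarrow> w = z \<or> dig_less w z))"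

lemma zero_digit_iff:
  assumes s: "s \<in> tail_class c"
  shows "zero_digit (tail_class c) n s \<longleftrightarrow> s n = 0"
proof -
  define t where "t i = (if i < n then 0 else s i)" for i
  have tc: "t \<in> tail_class c"
    by (rule tail_class_modify[OF s, of n]) (simp add: t_def)
  have "\<not> dig_less s t" unfolding dig_less_def t_def by (auto split: if_splits)
  then have ts: "t = s \<or> dig_less t s" using dig_less_total[OF tc s] by blast
  show ?thesis
  proof
    assume "zero_digit (tail_class c) n s"
    then obtain z where z: "z \<in> tail_class c" "limit_rank (tail_class c) (Suc n) z" "z = s \<or> dig_less z s"
      and max: "\<And>w. w \<in> tail_class c \<Longrightarrow> limit_rank (tail_class c) n w \<Longrightarrow>
         w = s \<or> dig_less w s \<Longrightarrow> w = z \<or> dig_less w z"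
      unfolding zero_digit_def by blast
    have z0: "z i = 0" if "i \<le> n" for i 
      using z(2) that unfolding limit_rank_iff[OF z(1)] by simp
    have "limit_rank (tail_class c) n t" using limit_rank_iff[OF tc] by (simp add: t_def)
    then have "t = z \<or> dig_less t z" using max tc ts by blast
    then show "s n = 0"
    proof
      assume "t = z"
      then have "t n = 0" using z0[of n] by simp
      then show ?thesis by (simp add: t_def)
    next
      assume "dig_less t z"
      then obtain k where k: "t k < z k" "\<forall>m>k. t m = z m" unfolding dig_less_def by blast
      \<comment> \<open>Above \<open>n\<close> the sequences \<open>s\<close> and \<open>t\<close>
        agree, so the comparison of \<open>t\<close> with \<open>z\<close> carries over to
        \<open>s\<close>, against the choice of \<open>z\<close> at or below
        \<open>s\<close>.\<close>
      have "k > n" using k(1) z0[of k] by (cases "k \<le> n") auto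
      then have "dig_less s z"
        unfolding dig_less_def using k by (intro exI[of _ k]) (simp add: t_def)
      then show ?thesis using z(3) dig_less_irrefl dig_less_asym by blast
    qed
  next
    assume sn: "s n = 0"
    have "w = t \<or> dig_less w t"
      if w: "w \<in> tail_class c" "limit_rank (tail_class c) n w" "w = s \<or> dig_less w s" for w
    proof (rule ccontr)
      assume "\<not> ?thesis"
      then have "dig_less t w" using dig_less_total[OF w(1) tc] by blast
      then obtain k where k: "t k < w k" "\<forall>m>k. t m = w m" unfolding dig_less_def by blast
      have "k \<ge> n" using k(1) w(2) limit_rank_iff[OF w(1)] by (cases "k \<ge> n") auto
      then have "dig_less s w"
        unfolding dig_less_def using k by (intro exI[of _ k]) (simp add: t_def)
      then show False using w(3) dig_less_irrefl dig_less_asym by blast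
    qed
    moreover have "limit_rank (tail_class c) (Suc n) t"
      unfolding limit_rank_iff[OF tc] using sn by (simp add: t_def less_Suc_eq)
    ultimately show "zero_digit (tail_class c) n s"
      unfolding zero_digit_def using tc ts by blast
  qed
qed

lemma zero_digit_image:
  assumes "\<And>x y. x \<in> S \<Longrightarrow> y \<in> S \<Longrightarrow> dig_less (h x) (h y) \<longleftrightarrow> dig_less x y" "inj_on h S"
  shows "s \<in> S \<Longrightarrow> zero_digit (h ` S) n (h s) \<longleftrightarrow> zero_digit S n s"
proof -
  have rank: "limit_rank (h ` S) n (h s) \<longleftrightarrow> limit_rank S n s" if "s \<in> S" for n s
    using that by (induction n arbitrary: s) (simp_all add: assms(1))
  have eq: "h x = h y \<longleftrightarrow> x = y" if "x \<in> S" "y \<in> S" for x y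
    using assms(2) that by (simp add: inj_on_eq_iff)
  show "s \<in> S \<Longrightarrow> zero_digit (h ` S) n (h s) \<longleftrightarrow> zero_digit S n s"
    unfolding zero_digit_def bex_simps ball_simps
    by (simp add: rank eq assms(1) del: limit_rank.simps cong: bex_cong ball_cong)
qed

text \<open>The isomorphism preserves each vanishing digit, so \<open>c\<close> and
  \<open>h c\<close> vanish at the same places; and \<open>h c\<close>, as a member of the class of
  \<open>d\<close>, eventually equals \<open>d\<close>.\<close>

lemma no_iso_tail_classes:
  assumes "h ` tail_class c = tail_class d" "inj_on h (tail_class c)"
    "\<And>x y. x \<in> tail_class c \<Longrightarrow> y \<in> tail_class c \<Longrightarrow> dig_less (h x) (h y) \<longleftrightarrow> dig_less x y"
  shows "\<forall>\<^sub>F n in sequentially. c n = 0 \<longleftrightarrow> d n = 0"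
proof -
  have c: "c \<in> tail_class c" by (simp add: tail_class_def)
  then have hc: "h c \<in> tail_class d" using assms(1) by blast
  have "c n = 0 \<longleftrightarrow> h c n = 0" for n
    using zero_digit_image[OF assms(3,2) c, of n] zero_digit_iff[OF c] zero_digit_iff[OF hc]
    unfolding assms(1) by simp
  moreover have "\<forall>\<^sub>F n in sequentially. h c n = d n" using hc by (simp add: tail_class_def)
  ultimately show ?thesis by (auto elim: eventually_mono)
qed

section \<open>Cuts preserved by an isomorphism\<close>

lemma ex_w1: "\<exists>i. i \<in> w1"
  using infinite_w1 by (metis finite.emptyI ex_in_conv)

text \<open>The least element is excluded because continuity asks for an earlier stage even for a
  point that lies in all stages.\<close>

definition w1_limit :: "nat set \<Rightarrow> bool" where
  "w1_limit i \<longleftrightarrow> i \<in> w1 \<and> (\<exists>k. w1_less k i) \<and>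
     (\<forall>k. w1_less k i \<longrightarrow> (\<exists>k'. w1_less k k' \<and> w1_less k' i))"

text \<open>The club argument: close off alternately under \<open>f\<close> and \<open>g\<close> and take the supremum.\<close>

lemma common_closure_point:
  assumes monoP: "\<And>i j. w1_less i j \<Longrightarrow> P i \<subseteq> P j" and monoQ: "\<And>i j. w1_less i j \<Longrightarrow> Q i \<subseteq> Q j"
    and contP: "\<And>i x. w1_limit i \<Longrightarrow> x \<in> P i \<Longrightarrow>
       \<exists>k. w1_less k i \<and> x \<in> P k"
    and contQ: "\<And>i x. w1_limit i \<Longrightarrow> x \<in> Q i \<Longrightarrow>
       \<exists>k. w1_less k i \<and> x \<in> Q k"
    and f: "\<And>i. i \<in> w1 \<Longrightarrow> \<exists>j\<in>w1. f ` P i \<subseteq> Q j" and g: "\<And>i. i \<in> w1 \<Longrightarrow> \<exists>j\<in>w1. g ` Q i \<subseteq> P j"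
  shows "\<exists>i\<in>w1. f ` P i \<subseteq> Q i \<and> g ` Q i \<subseteq> P i"
proof -
  have step: "\<exists>k. k \<in> w1 \<and> (w1_less i k \<and> f ` P i \<subseteq> Q k \<and> g ` Q i \<subseteq> P k)" if i: "i \<in> w1" for i
  proof -
    obtain j j' where j: "j \<in> w1" "f ` P i \<subseteq> Q j" "j' \<in> w1" "g ` Q i \<subseteq> P j'"
      using f[OF i] g[OF i] by blast
    \<comment> \<open>A sequence with the three values \<open>i\<close>, \<open>j\<close>,
      \<open>j'\<close>, so that the countable bound yields one \<open>k\<close> above them
      all.\<close>
    define a where "a n = (if n = 0 then i else if n = 1 then j else j')" for n :: nat
    have "a n \<in> w1" for n using i j by (simp add: a_def)
    then obtain k where k: "k \<in> w1" "\<And>n. w1_less (a n) k" using w1_countable_bound[of a] by blast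
    have "w1_less i k" "w1_less j k" "w1_less j' k"
      using k(2)[of 0] k(2)[of 1] k(2)[of 2] by (simp_all add: a_def)
    then show ?thesis using k(1) j(2,4) monoQ[of j k] monoP[of j' k] by blast
  qed
  obtain a where a: "\<And>n::nat. a n \<in> w1"
    "\<And>n. w1_less (a n) (a (Suc n)) \<and> f ` P (a n) \<subseteq> Q (a (Suc n)) \<and> g ` Q (a n) \<subseteq> P (a (Suc n))"
    using dependent_nat_choice[of "\<lambda>_ i. i \<in> w1"
        "\<lambda>_ i k. w1_less i k \<and> f ` P i \<subseteq> Q k \<and> g ` Q i \<subseteq> P k"] step ex_w1 by metis
  obtain i where i: "i \<in> w1" "\<And>n. w1_less (a n) i"
    "\<And>k. w1_less k i \<Longrightarrow> \<exists>n. k = a n \<or> w1_less k (a n)"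
    using w1_sup[of a] a(1) by metis
  have below: "\<exists>n. w1_less k (a n)" if "w1_less k i" for k
    using i(3)[OF that] a(2) by blast
  then have lim: "\<forall>k. w1_less k i \<longrightarrow> (\<exists>k'. w1_less k k' \<and> w1_less k' i)"
    using i(2) by blast
  with i(1,2) have lim: "w1_limit i" unfolding w1_limit_def by blast
  \<comment> \<open>By continuity \<open>x\<close> already occurs before the limit, hence in some
    \<open>P (a n)\<close>, and the next member of the sequence captures its image.\<close>
  have "f x \<in> Q i" if x: "x \<in> P i" for x
  proof -
    obtain k n where "x \<in> P k" "w1_less k (a n)" using contP[OF lim x] below by blast
    then have "f x \<in> Q (a (Suc n))" using monoP a(2)[of n] by blast
    then show ?thesis using monoQ[OF i(2)] by blast
  qed
  moreover have "g x \<in> P i" if x: "x \<in> Q i" for x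
  proof -
    obtain k n where "x \<in> Q k" "w1_less k (a n)" using contQ[OF lim x] below by blast
    then have "g x \<in> P (a (Suc n))" using monoQ a(2)[of n] by blast
    then show ?thesis using monoP[OF i(2)] by blast
  qed
  ultimately show ?thesis using i(1) by blast
qed

lemma points_fst: "x \<in> points p \<Longrightarrow> fst x n \<in> Field A_ord"
  by (auto simp: points_def)

lemma points_ex: "(\<And>n. u n \<in> Field A_ord) \<Longrightarrow> \<exists>s. (u, s) \<in> points p"
  by (rule exI[of _ "base p u"]) (simp add: points_def tail_class_def)

text \<open>Only weak monotonicity of the first components: an isomorphism might a priori send
  points of different blocks into one block.\<close>

definition lex_respecting where
  "lex_respecting lt p f \<longleftrightarrow> (\<forall>x\<in>points p. \<forall>y\<in>points p.
     lex_less lt (fst x) (fst y) \<longrightarrow> \<not> lex_less lt (fst (f y)) (fst (f x)))"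

text \<open>Positive entries are chosen for \<open>lt = A_less\<close>, negative ones for its converse.\<close>

locale stage = strict_linear "Field A_ord" lt for lt :: "nat set + nat set \<Rightarrow> nat set + nat set \<Rightarrow> bool" +
  fixes e :: "nat set \<Rightarrow> nat set + nat set"
  assumes e_in: "i \<in> w1 \<Longrightarrow> e i \<in> Field A_ord"
    and e_mono: "w1_less i j \<Longrightarrow> lt (e i) (e j)"
    and e_cofinal: "a \<in> Field A_ord \<Longrightarrow> \<exists>j\<in>w1. lt a (e j)"
    and e_cont: "w1_limit i \<Longrightarrow>
      lt a (e i) \<Longrightarrow> \<exists>k. w1_less k i \<and> lt a (e k)"
begin

text \<open>One point \<open>x0\<close> with first component \<open>u(n := e i)\<close> bounds all
  images: its own image is not beyond the cone of the first \<open>n\<close> entries of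
  \<open>u\<close>, so cofinality of \<open>e\<close> finds a \<open>j\<close> whose cone lies
  beyond that image.\<close>

lemma image_bounded:
  assumes u: "\<And>n. u n \<in> Field A_ord" and i: "i \<in> w1"
    and f: "\<And>x. x \<in> points p \<Longrightarrow> f x \<in> points q" and gf: "\<And>x. x \<in> points p \<Longrightarrow> g (f x) = x"
    and resp: "lex_respecting lt p f"
    and g: "\<And>y. y \<in> points q \<Longrightarrow> lex_upto lt n u (fst y) \<Longrightarrow> lex_upto lt n u (fst (g y))"
  shows "\<exists>j\<in>w1. \<forall>x\<in>points p. lex_upto lt (Suc n) (fst x) (u(n := e i)) \<longrightarrow>
    lex_upto lt (Suc n) (fst (f x)) (u(n := e j))"
proof -
  have "\<exists>s. (u(n := e i), s) \<in> points p"
    by (rule points_ex) (simp add: u e_in[OF i])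
  then obtain s where x0: "(u(n := e i), s) \<in> points p" ..
  define v where "v = fst (f (u(n := e i), s))"
  have v: "v m \<in> Field A_ord" for m unfolding v_def by (rule points_fst[OF f[OF x0]])
  \<comment> \<open>Otherwise \<open>g\<close> would return a point beyond the cone, whereas
    \<open>u(n := e i)\<close> lies inside it.\<close>
  have "\<not> lex_upto lt n u v"
  proof
    assume "lex_upto lt n u v"
    then have "lex_upto lt n u (u(n := e i))"
      using g[OF f[OF x0]] unfolding gf[OF x0] v_def by simp
    then show False using lex_upto_irrefl[of n u "u(n := e i)"] by simp
  qed
  moreover have "(\<forall>m<n. u m = v m) \<or> lex_upto lt n u v \<or> lex_upto lt n v u"
    by (rule lex_upto_total[OF u v])
  ultimately have vu: "lex_upto lt n v u \<or> (\<forall>m<n. u m = v m)" by argo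
  obtain j where j: "j \<in> w1" "lt (v n) (e j)" using e_cofinal[OF v] by blast
  have vj: "lex_upto lt (Suc n) v (u(n := e j))"
    using vu
  proof
    assume "lex_upto lt n v u"
    then have "lex_upto lt n v (u(n := e j))" by (rule lex_upto_agree) simp
    then show ?thesis by (rule lex_upto_mono) simp
  next
    assume "\<forall>m<n. u m = v m"
    then show ?thesis unfolding lex_upto_def using j(2) by (intro exI[of _ n]) auto
  qed
  have "lex_upto lt (Suc n) (fst (f x)) (u(n := e j))"
    if x: "x \<in> points p" and less: "lex_upto lt (Suc n) (fst x) (u(n := e i))" for x
  proof -
    have "lex_less lt (fst x) (fst (u(n := e i), s))" using less unfolding lex_less_def by auto
    then have "\<not> lex_less lt v (fst (f x))"
      using resp x x0 unfolding lex_respecting_def v_def by blast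
    then have "\<not> lex_upto lt (Suc n) v (fst (f x))" unfolding lex_less_def by iprover
    moreover have "(\<forall>m<Suc n. fst (f x) m = v m) \<or>
        lex_upto lt (Suc n) (fst (f x)) v \<or> lex_upto lt (Suc n) v (fst (f x))"
      by (rule lex_upto_total[OF points_fst[OF f[OF x]] v])
    ultimately consider "\<forall>m<Suc n. fst (f x) m = v m" | "lex_upto lt (Suc n) (fst (f x)) v" by argo
    then show ?thesis using vj by cases (rule lex_upto_agree(2), assumption+, rule lex_upto_trans)
  qed
  with j(1) show ?thesis by blast
qed

text \<open>Only a comparison decided at place \<open>n\<close> depends on \<open>i\<close>, and
  there the continuity of \<open>e\<close> applies; a comparison decided earlier holds for every
  \<open>k\<close>.\<close>

lemma lex_upto_cont:
  assumes lim: "w1_limit i" and less: "lex_upto lt (Suc n) v (u(n := e i))"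
  shows "\<exists>k. w1_less k i \<and> lex_upto lt (Suc n) v (u(n := e k))"
proof -
  obtain m where m: "m < Suc n" "\<forall>l<m. v l = (u(n := e i)) l" "lt (v m) ((u(n := e i)) m)"
    using less unfolding lex_upto_def by blast
  show ?thesis
  proof (cases "m = n")
    case True
    then obtain k where "w1_less k i" "lt (v n) (e k)" using e_cont[OF lim] m(3) by auto
    then show ?thesis unfolding lex_upto_def using m True by (intro exI[of _ k]) auto
  next
    case False
    then have "lex_upto lt (Suc n) v (u(n := e k))" for k
      unfolding lex_upto_def using m by (intro exI[of _ m]) auto
    then show ?thesis using lim unfolding w1_limit_def by blast
  qed
qed

lemma lex_upto_e_mono:
  assumes "w1_less i j" "lex_upto lt (Suc n) v (u(n := e i))"
  shows "lex_upto lt (Suc n) v (u(n := e j))"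
proof -
  have "lex_upto lt (Suc n) (u(n := e i)) (u(n := e j))"
    unfolding lex_upto_def using e_mono[OF assms(1)] by (intro exI[of _ n]) simp
  with assms(2) show ?thesis by (rule lex_upto_trans)
qed


text \<open>Given a fixed cut at the far end of a cone, the subcones of \<open>e i\<close> run
  towards that end. The sets \<open>D r i\<close> of points before these subcones increase
  continuously, and \<open>common_closure_point\<close> finds one that both maps respect.\<close>

lemma common_cut:
  assumes u: "\<And>n. u n \<in> Field A_ord"
    and f: "\<And>x. x \<in> points p \<Longrightarrow> f x \<in> points q" "\<And>x. x \<in> points p \<Longrightarrow> g (f x) = x"
      "lex_respecting lt p f"
    and g: "\<And>y. y \<in> points q \<Longrightarrow> g y \<in> points p" "\<And>y. y \<in> points q \<Longrightarrow> f (g y) = y"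
      "lex_respecting lt q g"
    and cut: "\<And>x. x \<in> points p \<Longrightarrow> lex_upto lt n u (fst x) \<Longrightarrow> lex_upto lt n u (fst (f x))"
      "\<And>y. y \<in> points q \<Longrightarrow> lex_upto lt n u (fst y) \<Longrightarrow> lex_upto lt n u (fst (g y))"
  shows "\<exists>i\<in>w1.
    (\<forall>x\<in>points p. lex_upto lt (Suc n) (fst x) (u(n := e i)) \<longrightarrow> lex_upto lt (Suc n) (fst (f x)) (u(n := e i))) \<and>
    (\<forall>y\<in>points q. lex_upto lt (Suc n) (fst y) (u(n := e i)) \<longrightarrow> lex_upto lt (Suc n) (fst (g y)) (u(n := e i)))"
proof -
  define D where "D r i = {x \<in> points r. lex_upto lt (Suc n) (fst x) (u(n := e i))}" for r i
  have mono: "D r i \<subseteq> D r j" if "w1_less i j" for r i j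
    using lex_upto_e_mono[OF that] by (auto simp: D_def)
  have cont: "\<exists>k. w1_less k i \<and> x \<in> D r k" if "w1_limit i" "x \<in> D r i" for r i x
    using lex_upto_cont[OF that(1)] that(2) by (simp add: D_def)
  have "\<exists>i\<in>w1. f ` D p i \<subseteq> D q i \<and> g ` D q i \<subseteq> D p i"
  proof (rule common_closure_point)
    show "D p i \<subseteq> D p j" "D q i \<subseteq> D q j" if "w1_less i j" for i j
      by (rule mono[OF that])+
    show "\<exists>k. w1_less k i \<and> x \<in> D p k" if "w1_limit i" "x \<in> D p i" for i x
      using cont[OF that] .
    show "\<exists>k. w1_less k i \<and> x \<in> D q k" if "w1_limit i" "x \<in> D q i" for i x
      using cont[OF that] .
    show "\<exists>j\<in>w1. f ` D p i \<subseteq> D q j" if i: "i \<in> w1" for i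
    proof -
      obtain j where "j \<in> w1" "\<forall>x\<in>points p. lex_upto lt (Suc n) (fst x) (u(n := e i)) \<longrightarrow>
        lex_upto lt (Suc n) (fst (f x)) (u(n := e j))"
        using image_bounded[of u i p f q g n] u i f cut(2) by metis
      then show ?thesis using f(1) by (intro bexI[of _ j]) (auto simp: D_def)
    qed
    show "\<exists>j\<in>w1. g ` D q i \<subseteq> D p j" if i: "i \<in> w1" for i
    proof -
      obtain j where "j \<in> w1" "\<forall>x\<in>points q. lex_upto lt (Suc n) (fst x) (u(n := e i)) \<longrightarrow>
        lex_upto lt (Suc n) (fst (g x)) (u(n := e j))"
        using image_bounded[of u i q g p f n] u i g cut(1) by metis
      then show ?thesis using g(1) by (intro bexI[of _ j]) (auto simp: D_def)
    qed
  qed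
  then obtain i where i: "i \<in> w1" and sub: "f ` D p i \<subseteq> D q i" "g ` D q i \<subseteq> D p i" by blast
  have "lex_upto lt (Suc n) (fst (f x)) (u(n := e i))"
    if "x \<in> points p" "lex_upto lt (Suc n) (fst x) (u(n := e i))" for x
    using subsetD[OF sub(1), of "f x"] that by (simp add: D_def)
  moreover have "lex_upto lt (Suc n) (fst (g y)) (u(n := e i))"
    if "y \<in> points q" "lex_upto lt (Suc n) (fst y) (u(n := e i))" for y
    using subsetD[OF sub(2), of "g y"] that by (simp add: D_def)
  ultimately show ?thesis using i by (intro bexI[of _ i]) simp_all
qed

end

section \<open>Alternating between the two directions\<close>

interpretation up: stage A_less Inr
proof
  show "Inr i \<in> Field A_ord" if "i \<in> w1" for i using that by (simp add: Field_A)
  show "A_less (Inr i) (Inr j)" if "w1_less i j" for i j using that by simp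
  show "\<exists>j\<in>w1. A_less a (Inr j)" if "a \<in> Field A_ord" for a
    using that w1_unbounded unfolding Field_A by auto
  show "\<exists>k. w1_less k i \<and> A_less a (Inr k)" if "w1_limit i" "A_less a (Inr i)" for a i
    using that unfolding w1_limit_def by (cases a) (auto dest: w1_less_in)
qed

interpretation down: stage "A_less\<inverse>\<inverse>" Inl
proof
  show "\<not> A_less\<inverse>\<inverse> a a" for a using A.irrefl by simp
  show "A_less\<inverse>\<inverse> a c" if "A_less\<inverse>\<inverse> a b" "A_less\<inverse>\<inverse> b c" for a b c using that A.trans by auto
  show "A_less\<inverse>\<inverse> a b \<or> A_less\<inverse>\<inverse> b a" if "a \<in> Field A_ord" "b \<in> Field A_ord" "a \<noteq> b" for a b
    using A.total[OF that] by auto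
  show "Inl i \<in> Field A_ord" if "i \<in> w1" for i using that by (simp add: Field_A)
  show "A_less\<inverse>\<inverse> (Inl i) (Inl j)" if "w1_less i j" for i j using that by simp
  show "\<exists>j\<in>w1. A_less\<inverse>\<inverse> a (Inl j)" if "a \<in> Field A_ord" for a
    using that w1_unbounded unfolding Field_A by auto
  show "\<exists>k. w1_less k i \<and> A_less\<inverse>\<inverse> a (Inl k)" if "w1_limit i" "A_less\<inverse>\<inverse> a (Inl i)" for a i
    using that unfolding w1_limit_def by (cases a) (auto dest: w1_less_in)
qed

definition lt_at :: "nat \<Rightarrow> nat set + nat set \<Rightarrow> nat set + nat set \<Rightarrow> bool" where
  "lt_at n = (if even n then A_less else A_less\<inverse>\<inverse>)"

definition e_at :: "nat \<Rightarrow> nat set \<Rightarrow> nat set + nat set" where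
  "e_at n = (if even n then Inr else Inl)"

lemma stage_at: "stage (lt_at n) (e_at n)"
  unfolding lt_at_def e_at_def using up.stage_axioms down.stage_axioms by simp

text \<open>Reversing the direction turns the near end of a cone into its far end, so the conclusion
  of \<open>common_cut\<close> at one stage is its hypothesis at the next.\<close>

lemma lex_upto_lt_at_Suc: "lex_upto (lt_at (Suc n)) m u v \<longleftrightarrow> lex_upto (lt_at n) m v u"
  unfolding lt_at_def by (simp add: lex_upto_converse)

lemma lex_respecting_lt_at:
  assumes f: "\<And>x. x \<in> points p \<Longrightarrow> f x \<in> points q"
    and mono: "\<And>x y. x \<in> points p \<Longrightarrow> y \<in> points p \<Longrightarrow> point_less x y \<Longrightarrow> point_less (f x) (f y)"
  shows "lex_respecting (lt_at n) p f"
proof -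
  have "\<not> lex_less A_less (fst (f y)) (fst (f x))"
    if "x \<in> points p" "y \<in> points p" "lex_less A_less (fst x) (fst y)" for x y
  proof -
    have "point_less (f x) (f y)" using mono that by (simp add: point_less_def)
    then show ?thesis using point_less_trans point_less_irrefl unfolding point_less_def by metis
  qed
  then show ?thesis
    unfolding lex_respecting_def lt_at_def by (auto simp: lex_less_converse)
qed

lemma common_branch:
  assumes f: "\<And>x. x \<in> points p \<Longrightarrow> f x \<in> points q" "\<And>x. x \<in> points p \<Longrightarrow> g (f x) = x"
      "\<And>x y. x \<in> points p \<Longrightarrow> y \<in> points p \<Longrightarrow> point_less x y \<Longrightarrow> point_less (f x) (f y)"
    and g: "\<And>y. y \<in> points q \<Longrightarrow> g y \<in> points p" "\<And>y. y \<in> points q \<Longrightarrow> f (g y) = y"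
      "\<And>x y. x \<in> points q \<Longrightarrow> y \<in> points q \<Longrightarrow> point_less x y \<Longrightarrow> point_less (g x) (g y)"
  shows "\<exists>u. (\<forall>n. u n \<in> e_at n ` w1) \<and>
    (\<forall>n. (\<forall>x\<in>points p. lex_upto (lt_at n) n u (fst x) \<longrightarrow> lex_upto (lt_at n) n u (fst (f x))) \<and>
         (\<forall>y\<in>points q. lex_upto (lt_at n) n u (fst y) \<longrightarrow> lex_upto (lt_at n) n u (fst (g y))))"
proof -
  define I where "I n u \<longleftrightarrow>
    (\<forall>x\<in>points p. lex_upto (lt_at n) n u (fst x) \<longrightarrow> lex_upto (lt_at n) n u (fst (f x))) \<and>
    (\<forall>y\<in>points q. lex_upto (lt_at n) n u (fst y) \<longrightarrow> lex_upto (lt_at n) n u (fst (g y)))" for n u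
  have step: "\<exists>i\<in>w1. I (Suc n) (u(n := e_at n i))" if "\<forall>m. u m \<in> Field A_ord" "I n u" for n u
  proof -
    interpret stage "lt_at n" "e_at n" by (rule stage_at)
    show ?thesis unfolding I_def lex_upto_lt_at_Suc
      by (rule common_cut)
        (use that f g lex_respecting_lt_at[of p f q n, OF f(1,3)] lex_respecting_lt_at[of q g p n, OF g(1,3)]
          in \<open>simp_all add: I_def\<close>)
  qed
  obtain a0 where "a0 \<in> Field A_ord" using ex_w1 unfolding Field_A by blast
  \<comment> \<open>The initial sequence is arbitrary: nothing lies beyond the cone of the empty
    prefix, and every entry is replaced later.\<close>
  then have "\<exists>u. (\<forall>m. u m \<in> Field A_ord) \<and> I 0 u"
    by (intro exI[of _ "\<lambda>_. a0"]) (simp add: I_def lex_upto_def)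
  moreover have "\<exists>v. ((\<forall>m. v m \<in> Field A_ord) \<and> I (Suc n) v) \<and> (\<exists>i\<in>w1. v = u(n := e_at n i))"
    if uI: "(\<forall>m. u m \<in> Field A_ord) \<and> I n u" for n u
  proof -
    obtain i where i: "i \<in> w1" "I (Suc n) (u(n := e_at n i))" using step[of u n] uI by blast
    moreover have "e_at n i \<in> Field A_ord" using stage.e_in[OF stage_at i(1)] .
    ultimately show ?thesis using uI by (intro exI[of _ "u(n := e_at n i)"]) auto
  qed
  ultimately obtain w where w: "\<And>n. I n (w n)" "\<And>n. \<exists>i\<in>w1. w (Suc n) = (w n)(n := e_at n i)"
    using dependent_nat_choice[of "\<lambda>n u. (\<forall>m. u m \<in> Field A_ord) \<and> I n u"
        "\<lambda>n u v. \<exists>i\<in>w1. v = u(n := e_at n i)"] by metis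
  \<comment> \<open>Passing from stage \<open>k\<close> to \<open>k + 1\<close> changes entry
    \<open>k\<close> only, so entry \<open>n\<close> is final from stage \<open>n + 1\<close>
    on.\<close>
  define u where "u n = w (Suc n) n" for n
  have "w (n + k) m = w n m" if "m < n" for n k m
  proof (induction k)
    case (Suc k)
    obtain i where "w (Suc (n + k)) = (w (n + k))(n + k := e_at (n + k) i)" using w(2) by blast
    then show ?case using Suc that by simp
  qed simp
  then have agree: "\<forall>m<n. w n m = u m" for n
    unfolding u_def by (metis Suc_leI le_add_diff_inverse lessI)
  have "lex_upto lt n u v \<longleftrightarrow> lex_upto lt n (w n) v" for lt n v
    unfolding lex_upto_def using agree[of n] by (intro ex_cong) auto
  then have "I n u" for n using w(1)[of n] unfolding I_def by simp
  moreover have "u n \<in> e_at n ` w1" for n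
  proof -
    obtain i where "i \<in> w1" "w (Suc n) = (w n)(n := e_at n i)" using w(2) by blast
    then show ?thesis unfolding u_def by simp
  qed
  ultimately show ?thesis unfolding I_def by blast
qed

section \<open>Non-isomorphism\<close>

text \<open>A difference seen in some prefix is seen in all longer ones. Even stages therefore
  exclude that \<open>v\<close> is above \<open>u\<close>, and odd stages that it is below.\<close>

lemma eq_if_no_cut:
  assumes "\<And>n. u n \<in> Field A_ord" "\<And>n. v n \<in> Field A_ord" "\<And>n. \<not> lex_upto (lt_at n) n u v"
  shows "v = u"
proof (rule ccontr)
  assume "v \<noteq> u"
  then consider n where "lex_upto A_less n u v" | n where "lex_upto A_less n v u"
    using A.lex_less_total[of u v] assms(1,2) unfolding lex_less_def by blast
  then show False
  proof cases
    case 1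
    then have "lex_upto A_less (2 * n) u v" by (rule A.lex_upto_mono) simp
    then show False using assms(3)[of "2 * n"] by (simp add: lt_at_def)
  next
    case 2
    then have "lex_upto A_less (2 * n + 1) v u" by (rule A.lex_upto_mono) simp
    then show False using assms(3)[of "2 * n + 1"] by (simp add: lt_at_def lex_upto_converse)
  qed
qed

lemma not_order_iso_block_order: "\<not> order_iso (block_order 0) (block_order (Suc 0))"
proof
  assume "order_iso (block_order 0) (block_order (Suc 0))"
  then obtain f where bij: "bij_betw f (points 0) (points (Suc 0))"
    and iso: "\<And>x y. x \<in> points 0 \<Longrightarrow> y \<in> points 0 \<Longrightarrow> (x, y) \<in> block_order 0 \<longleftrightarrow> (f x, f y) \<in> block_order (Suc 0)"
    unfolding order_iso_def Field_block_order by blast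
  define g where "g = inv_into (points 0) f"
  have f: "f x \<in> points (Suc 0)" "g (f x) = x" if "x \<in> points 0" for x
    using bij_betw_apply[OF bij that] bij_betw_inv_into_left[OF bij that] by (simp_all add: g_def)
  have g: "g y \<in> points 0" "f (g y) = y" if "y \<in> points (Suc 0)" for y
    using bij_betw_apply[OF bij_betw_inv_into[OF bij] that] bij_betw_inv_into_right[OF bij that]
    by (simp_all add: g_def)
  have less_iff: "point_less x y \<longleftrightarrow> point_less (f x) (f y)" if "x \<in> points 0" "y \<in> points 0" for x y
  proof -
    have "f x = f y \<longleftrightarrow> x = y" using f(2) that by metis
    then show ?thesis
      using iso[OF that] that f(1) point_less_irrefl unfolding block_order_iff by metis
  qed
  have f_mono: "point_less (f x) (f y)" if "x \<in> points 0" "y \<in> points 0" "point_less x y" for x y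
    using less_iff that by blast
  have g_mono: "point_less (g x) (g y)" if "x \<in> points (Suc 0)" "y \<in> points (Suc 0)" "point_less x y" for x y
    using less_iff[of "g x" "g y"] that g by simp
  have "\<exists>u. (\<forall>n. u n \<in> e_at n ` w1) \<and>
    (\<forall>n. (\<forall>x\<in>points 0. lex_upto (lt_at n) n u (fst x) \<longrightarrow> lex_upto (lt_at n) n u (fst (f x))) \<and>
      (\<forall>y\<in>points (Suc 0). lex_upto (lt_at n) n u (fst y) \<longrightarrow> lex_upto (lt_at n) n u (fst (g y))))"
    by (rule common_branch) (fact f f_mono g g_mono)+
  then obtain u where u: "\<And>n. u n \<in> e_at n ` w1"
    and cut: "\<And>n x. x \<in> points 0 \<Longrightarrow> lex_upto (lt_at n) n u (fst x) \<Longrightarrow> lex_upto (lt_at n) n u (fst (f x))"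
      "\<And>n y. y \<in> points (Suc 0) \<Longrightarrow> lex_upto (lt_at n) n u (fst y) \<Longrightarrow> lex_upto (lt_at n) n u (fst (g y))"
    by blast
  have uA: "u n \<in> Field A_ord" for n
    using u[of n] stage.e_in[OF stage_at] by auto
  have irr: "\<not> lex_upto (lt_at n) n u u" for n
    using strict_linear.lex_upto_irrefl[of "Field A_ord" "lt_at n" n u u] stage_at[of n]
    unfolding stage_def by blast
  \<comment> \<open>If \<open>f x\<close> were beyond some cone around \<open>u\<close>, then
    \<open>g\<close> would put \<open>x\<close> beyond it as well, although \<open>x\<close> lies in
    the block of \<open>u\<close>. With \<open>g_block\<close>, \<open>f\<close> maps this block of
    \<open>X\<close> onto that of \<open>Y\<close>.\<close>
  have f_block: "fst (f x) = u" if x: "x \<in> points 0" "fst x = u" for x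
  proof (rule eq_if_no_cut[OF uA points_fst[OF f(1)[OF x(1)]]])
    show "\<not> lex_upto (lt_at n) n u (fst (f x))" for n
      using cut(2)[OF f(1)[OF x(1)], of n] irr[of n] unfolding f(2)[OF x(1)] x(2) by iprover
  qed
  have g_block: "fst (g y) = u" if y: "y \<in> points (Suc 0)" "fst y = u" for y
  proof (rule eq_if_no_cut[OF uA points_fst[OF g(1)[OF y(1)]]])
    show "\<not> lex_upto (lt_at n) n u (fst (g y))" for n
      using cut(1)[OF g(1)[OF y(1)], of n] irr[of n] unfolding g(2)[OF y(1)] y(2) by iprover
  qed
  have mem: "(u, s) \<in> points p \<longleftrightarrow> s \<in> tail_class (base p u)" for s p
    using uA by (simp add: points_def)
  define h where "h s = snd (f (u, s))" for s
  have fh: "f (u, s) = (u, h s)" if "s \<in> tail_class (base 0 u)" for s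
    using f_block[of "(u, s)"] that by (simp add: mem h_def prod_eq_iff)
  have less_h: "dig_less (h s) (h t) \<longleftrightarrow> dig_less s t"
    if "s \<in> tail_class (base 0 u)" "t \<in> tail_class (base 0 u)" for s t
    using less_iff[of "(u, s)" "(u, t)"] that
    by (simp add: mem fh point_less_def A.lex_less_irrefl)
  have inj: "inj_on h (tail_class (base 0 u))"
  proof (rule inj_onI)
    fix s t assume st: "s \<in> tail_class (base 0 u)" "t \<in> tail_class (base 0 u)" "h s = h t"
    then have "f (u, s) = f (u, t)" by (simp add: fh)
    then have "(u, s) = (u, t)" using f(2) st(1,2) by (metis mem)
    then show "s = t" by simp
  qed
  have img: "h ` tail_class (base 0 u) = tail_class (base (Suc 0) u)"
  proof (intro equalityI subsetI)
    fix t assume "t \<in> h ` tail_class (base 0 u)"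
    then obtain s where s: "t = h s" "s \<in> tail_class (base 0 u)" ..
    then have "f (u, s) \<in> points (Suc 0)" by (intro f(1)) (simp add: mem)
    then show "t \<in> tail_class (base (Suc 0) u)"
      using s by (simp add: fh mem)
  next
    fix t assume t: "t \<in> tail_class (base (Suc 0) u)"
    then have m: "(u, t) \<in> points (Suc 0)" by (simp add: mem)
    then have gt: "g (u, t) = (u, snd (g (u, t)))" using g_block[of "(u, t)"] by (simp add: prod_eq_iff)
    then have s: "snd (g (u, t)) \<in> tail_class (base 0 u)" using g(1)[OF m] by (metis mem)
    have "f (u, snd (g (u, t))) = (u, t)" using g(2)[OF m] gt by simp
    then have "h (snd (g (u, t))) = t" by (simp add: h_def)
    then show "t \<in> h ` tail_class (base 0 u)" using s by (rule image_eqI[OF sym])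
  qed
  have sign: "\<not> isl (u k) \<longleftrightarrow> even k" for k
    using u[of k] unfolding e_at_def by (auto split: if_splits)
  have "alternating u m \<longleftrightarrow> even m" for m
    unfolding alternating_def sign by (cases "even m") simp_all
  then have "base 0 u n = of_bool (even n)" "base (Suc 0) u n = of_bool (odd n)" for n
    by (simp_all add: base_def)
  \<comment> \<open>The two base sequences vanish at complementary sets of places, so they cannot
    eventually vanish together.\<close>
  then show False
    using no_iso_tail_classes[OF img inj less_h] by simp
qed

section \<open>Transfer to orders on \<open>nat set set\<close>\<close>

text \<open>A point consists of countably many subsets of the naturals, signs and digits, which one
  set of naturals can store. The tag \<open>j\<close> separates the three kinds of data; the outer
  singleton only adjusts the type.\<close>

definition code :: "(nat \<Rightarrow> nat set + nat set) \<times> (nat \<Rightarrow> nat) \<Rightarrow> nat set set" where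
  "code x = {{prod_encode (n, prod_encode (j, k)) | n j k.
     j = 0 \<and> k \<in> case_sum id id (fst x n) \<or> j = 1 \<and> isl (fst x n) \<or> j = 2 \<and> k = snd x n}}"

lemma inj_code: "inj code"
proof (rule injI)
  let ?C = "\<lambda>x :: (nat \<Rightarrow> nat set + nat set) \<times> (nat \<Rightarrow> nat). \<lambda>n j k :: nat.
    j = 0 \<and> k \<in> case_sum id id (fst x n) \<or> j = 1 \<and> isl (fst x n) \<or> j = 2 \<and> k = snd x n"
  fix x y assume "code x = code y"
  then have sets: "{prod_encode (n, prod_encode (j, k)) | n j k. ?C x n j k} =
      {prod_encode (n, prod_encode (j, k)) | n j k. ?C y n j k}"
    unfolding code_def by (rule singleton_inject)
  have mem: "prod_encode (n, prod_encode (j, k)) \<in> {prod_encode (n, prod_encode (j, k)) | n j k. ?C z n j k}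
      \<longleftrightarrow> ?C z n j k" for z and n j k :: nat
    by simp
  have eq: "?C x n j k \<longleftrightarrow> ?C y n j k" for n j k :: nat
    using mem[of n j k x] unfolding sets mem ..
  have "fst x n = fst y n" for n
  proof -
    have "case_sum id id (fst x n) = case_sum id id (fst y n)"
      using eq[of 0 _ n] by auto
    moreover have "isl (fst x n) \<longleftrightarrow> isl (fst y n)"
      using eq[of 1 0 n] by auto
    ultimately show ?thesis by (cases "fst x n"; cases "fst y n") auto
  qed
  moreover have "snd x n = snd y n" for n
    using eq[of 2 "snd x n" n] by auto
  ultimately show "x = y" by (simp add: prod_eq_iff fun_eq_iff)
qed

theorem mainTheorem1:
  shows "\<exists>(X :: nat set set rel) (Y :: nat set set rel).
           Linear_order X \<and> Linear_order Y \<and> \<not> order_iso X Y \<and>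
           order_iso X (lexi_prod A_ord Y) \<and> order_iso X (lexi_prod Y omega_ord) \<and>
           order_iso Y (lexi_prod A_ord X) \<and> order_iso Y (lexi_prod X omega_ord)"
proof -
  define Z where "Z p = map_prod code code ` block_order p" for p
  have lin: "Linear_order (Z p)" for p
    unfolding Z_def by (rule Linear_order_image[OF inj_code Linear_order_block_order])
  then have refl: "Refl (Z p)" for p
    unfolding order_on_defs by blast
  have ZR: "order_iso (block_order p) (Z p)" for p
    unfolding Z_def by (rule order_iso_image[OF inj_code])
  have A_times: "order_iso (Z p) (lexi_prod A_ord (Z (Suc p)))" for p
    using order_iso_sym[OF ZR] block_order_iso_A_times
      order_iso_lexi_prod[OF order_iso_refl ZR Refl_A Refl_block_order Refl_A refl]
    by (rule order_iso_trans[OF order_iso_trans])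
  have times_omega: "order_iso (Z p) (lexi_prod (Z (Suc p)) omega_ord)" for p
    using order_iso_sym[OF ZR] block_order_iso_times_omega
      order_iso_lexi_prod[OF ZR order_iso_refl Refl_block_order omega(2) refl omega(2)]
    by (rule order_iso_trans[OF order_iso_trans])
  \<comment> \<open>Dividing twice returns to the start, which closes the cycle between
    \<open>X = Z 0\<close> and \<open>Y = Z 1\<close>.\<close>
  have period: "Z (Suc (Suc 0)) = Z 0" unfolding Z_def block_order_add2 ..
  have "\<not> order_iso (Z 0) (Z (Suc 0))"
    using not_order_iso_block_order order_iso_trans[OF order_iso_trans[OF ZR] order_iso_sym[OF ZR]] by blast
  then show ?thesis
    using lin A_times[of 0] A_times[of "Suc 0"] times_omega[of 0] times_omega[of "Suc 0"]
    unfolding period by blast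
qed

end
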